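(* Let $t$ be a positive integer and let $K_n$ be a complete graph on $n$ vertices. Then $$c\chi_2^t(K_n)=\begin{cases}\frac{3n}{2},&\text{if } t=1 \text{ and } n\text{ is even},\\[1mm] \frac{3n+1}{2},&\text{if } t=1\text{ and } n\text{ is odd},\\[1mm] n,&\text{if } t\ge 2.\end{cases}$$
   Context: Graphs are undirected and simple. For a positive integer $k$ and $i,j\in\{0,1,\dots,k-1\}$, the circular distance is $|i-j|_k=\min\{|i-j|,\,k-|i-j|\}$. For a nonnegative integer $t$, a $(\frac{k}{2},t)^*$-coloring of a graph $G$ is a mapping $f:V(G)\to\{0,1,\dots,k-1\}$ such that adjacent vertices receive different integers and, for each vertex $u$, the number of neighbors $v$ of $u$ with $|f(u)-f(v)|_k=1$ is at most $t$. $G$ is $(\frac{k}{2},t)^*$-colorable if it has such a coloring. (The symbol $\frac{k}{2}$ is formal notation recording the pair $(k,2)$, not a reduced fraction.) The $t$-relaxed 2-distant circular chromatic number $c\chi_2^t(G)$ is the minimum integer $k$ such that $G$ is $(\frac{k}{2},t)^*$-colorable.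
   Formalization: For t = 1 the formal theorem assumes n ≥ 3, since the formula fails there for smaller n: with t = 1, K_1 has value 1 (formula gives 2) and K_2 has value 2 (k = 2, colors 0, 1; formula gives 3); K_n is taken with n ≥ 1. *)

theory Defs
  imports Complex_Main "Graph_Theory.Kuratowski"
begin

(* Undirected simple graphs are the symmetric, loop-free digraphs without parallel
   arcs of the locale "graph" of Graph_Theory (they are finite); u and v are adjacent
   iff u \<rightarrow>\<^bsub>G\<^esub> v. The predicate K\<^bsub>n\<^esub> G says that G is a complete graph on n vertices. *)

(* int-valued, so that no subtraction truncates *)
definition circ_dist :: "nat \<Rightarrow> nat \<Rightarrow> nat \<Rightarrow> int" where
  "circ_dist k i j = min \<bar>int i - int j\<bar> (int k - \<bar>int i - int j\<bar>)"

(* (k/2, t)*-colorings; the "fraction" k/2 only records the pair (k, 2), hence the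
   single parameter k *)
definition relaxed_coloring ::
    "('a, 'b) pre_digraph \<Rightarrow> nat \<Rightarrow> nat \<Rightarrow> ('a \<Rightarrow> nat) \<Rightarrow> bool" where
  "relaxed_coloring G k t f \<longleftrightarrow>
     (\<forall>u\<in>verts G. f u \<in> {0..<k}) \<and>
     (\<forall>u\<in>verts G. \<forall>v\<in>verts G. u \<rightarrow>\<^bsub>G\<^esub> v \<longrightarrow> f u \<noteq> f v) \<and>
     (\<forall>u\<in>verts G. card {v \<in> verts G. u \<rightarrow>\<^bsub>G\<^esub> v \<and> circ_dist k (f u) (f v) = 1} \<le> t)"

definition relaxed_colorable :: "('a, 'b) pre_digraph \<Rightarrow> nat \<Rightarrow> nat \<Rightarrow> bool" where
  "relaxed_colorable G k t \<longleftrightarrow> (\<exists>f. relaxed_coloring G k t f)"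

(* For finite G the set of admissible k is nonempty: give the vertices distinct even colors. *)
definition relaxed_circ_chromatic_number :: "nat \<Rightarrow> ('a, 'b) pre_digraph \<Rightarrow> nat" where
  "relaxed_circ_chromatic_number t G = (LEAST k. 0 < k \<and> relaxed_colorable G k t)"

end

theory Submission
  imports Defs
begin

text \<open>A coloring of a complete graph is just the choice of an n-element set S of colors. At most two
  colors are at circular distance 1 from a given color, so t \<ge> 2 imposes nothing. For t = 1, every
  s in S has a cyclic neighbour outside S, while each of the k - n unused colors is a cyclic
  neighbour of at most two elements of S; hence n \<le> 2 (k - n). The colors 0, 1, 3, 4, 6, 7, \<dots>
  attain this bound.\<close>

text \<open>The cyclic predecessor is written \<open>(i + k - 1) mod k\<close> because
  \<open>i - 1\<close> would truncate at \<open>i = 0\<close>.\<close>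

lemma circ_dist_eq_1_cases:
  assumes "i < k" "j < k" "circ_dist k i j = 1"
  shows "j = (i + 1) mod k \<or> j = (i + k - 1) mod k"
proof -
  have "int j = int i + 1 \<or> int i = int j + 1 \<or> (int i = 0 \<and> int j = int k - 1)
      \<or> (int j = 0 \<and> int i = int k - 1)"
    using assms unfolding circ_dist_def by linarith
  then consider "j = i + 1" | "i = j + 1" | "i = 0" "j = k - 1" | "j = 0" "i + 1 = k"
    using assms by linarith
  then show ?thesis
    using assms by cases auto
qed

lemma pred_mod_eq:
  assumes "i < (k::nat)"
  shows "(i + k - 1) mod k = (if i = 0 then k - 1 else i - 1)"
  using assms by (cases i) auto

lemma circ_dist_succ:
  assumes "2 \<le> k" "i < k"
  shows "circ_dist k i ((i + 1) mod k) = 1"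
  using assms by (cases "i + 1 = k") (auto simp: circ_dist_def min_def)

lemma circ_dist_pred:
  assumes "2 \<le> k" "i < k"
  shows "circ_dist k i ((i + k - 1) mod k) = 1"
  unfolding pred_mod_eq[OF assms(2)] using assms
  by (auto simp: circ_dist_def min_def of_nat_diff)

lemma inj_on_succ_mod: "inj_on (\<lambda>i. (i + 1) mod k) {..<k::nat}"
  by (rule inj_onI) (auto simp: mod_Suc split: if_splits)

lemma inj_on_pred_mod: "inj_on (\<lambda>i. (i + k - 1) mod k) {..<k::nat}"
proof (rule inj_onI)
  fix i j assume "i \<in> {..<k}" "j \<in> {..<k}" "(i + k - 1) mod k = (j + k - 1) mod k"
  then show "i = j"
    using pred_mod_eq[of i k] pred_mod_eq[of j k] by (simp split: if_splits)
qed

lemma succ_mod_neq_pred_mod: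
  assumes "3 \<le> k" "i < (k::nat)"
  shows "(i + 1) mod k \<noteq> (i + k - 1) mod k"
  unfolding pred_mod_eq[OF assms(2)] using assms by (cases "i + 1 = k") auto

definition relaxed_color_set :: "nat \<Rightarrow> nat \<Rightarrow> nat set \<Rightarrow> bool" where
  "relaxed_color_set k t S \<longleftrightarrow>
     S \<subseteq> {..<k} \<and> (\<forall>s\<in>S. card {r \<in> S. r \<noteq> s \<and> circ_dist k s r = 1} \<le> t)"

lemma relaxed_colorable_complete_iff:
  assumes "K\<^bsub>n\<^esub> G"
  shows "relaxed_colorable G k t \<longleftrightarrow> (\<exists>S. relaxed_color_set k t S \<and> card S = n)"
proof -
  interpret graph G using assms by (simp add: complete_digraph_def)
  have card_V: "card (verts G) = n"
    using assms by (auto simp: complete_digraph_def)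
  have adj: "u \<rightarrow>\<^bsub>G\<^esub> v \<longleftrightarrow> u \<noteq> v" if "u \<in> verts G" "v \<in> verts G" for u v
    using assms that by (auto simp: complete_digraph_def)
  have nbrs: "f ` {v \<in> verts G. u \<rightarrow>\<^bsub>G\<^esub> v \<and> circ_dist k (f u) (f v) = 1}
        = {r \<in> f ` verts G. r \<noteq> f u \<and> circ_dist k (f u) r = 1}"
    if "inj_on f (verts G)" "u \<in> verts G" for f u
    using that adj by (auto simp: inj_on_def)
  have coloring_iff: "relaxed_coloring G k t f \<longleftrightarrow> relaxed_color_set k t (f ` verts G)"
    if "inj_on f (verts G)" for f
  proof -
    have "card {v \<in> verts G. u \<rightarrow>\<^bsub>G\<^esub> v \<and> circ_dist k (f u) (f v) = 1}
        = card {r \<in> f ` verts G. r \<noteq> f u \<and> circ_dist k (f u) r = 1}" if "u \<in> verts G" for u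
      unfolding nbrs[OF \<open>inj_on f (verts G)\<close> that, symmetric]
      by (rule card_image[symmetric], rule inj_on_subset[OF \<open>inj_on f (verts G)\<close>]) auto
    moreover have "\<forall>u\<in>verts G. \<forall>v\<in>verts G. u \<rightarrow>\<^bsub>G\<^esub> v \<longrightarrow> f u \<noteq> f v"
      using that adj by (auto simp: inj_on_def)
    ultimately show ?thesis
      unfolding relaxed_coloring_def relaxed_color_set_def by auto
  qed
  show ?thesis
  proof (rule iffI)
    assume "relaxed_colorable G k t"
    then obtain f where f: "relaxed_coloring G k t f"
      by (auto simp: relaxed_colorable_def)
    then have "inj_on f (verts G)"
      using adj by (auto simp: relaxed_coloring_def inj_on_def)
    with f show "\<exists>S. relaxed_color_set k t S \<and> card S = n"
      using coloring_iff card_V by (metis card_image)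
  next
    assume "\<exists>S. relaxed_color_set k t S \<and> card S = n"
    then obtain S where S: "relaxed_color_set k t S" "card S = n" by blast
    then have "finite S"
      unfolding relaxed_color_set_def using finite_subset by blast
    then obtain f where "bij_betw f (verts G) S"
      using finite_same_card_bij[OF finite_verts \<open>finite S\<close>] card_V S(2) by auto
    with S(1) coloring_iff show "relaxed_colorable G k t"
      by (auto simp: relaxed_colorable_def bij_betw_def)
  qed
qed

lemma card_relaxed_color_set_le:
  assumes "relaxed_color_set k t S"
  shows "card S \<le> k"
  using assms card_mono[of "{..<k}" S] by (auto simp: relaxed_color_set_def)

text \<open>The assumption \<open>3 \<le> k\<close> makes the two cyclic neighbours of a color
  distinct. For \<open>k = 2\<close> they coincide, and the full set {0, 1} is admissible but
  violates the bound.\<close>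

lemma relaxed_color_set_1_bound:
  assumes S: "relaxed_color_set k 1 S" and "3 \<le> k"
  shows "3 * card S \<le> 2 * k"
proof -
  define succ pred where "succ i = (i + 1) mod k" and "pred i = (i + k - 1) mod k" for i :: nat
  define g where "g s = (if succ s \<notin> S then (succ s, True) else (pred s, False))" for s
  have sub: "S \<subseteq> {..<k}" using S by (simp add: relaxed_color_set_def)
  then have [simp]: "finite S" using finite_subset by blast
  have free: "pred s \<notin> S" if "s \<in> S" "succ s \<in> S" for s
  proof
    assume "pred s \<in> S"
    have s: "s < k" using sub that by auto
    \<comment> \<open>This separates \<open>s\<close> from \<open>succ s\<close> and
      \<open>pred s\<close>, which lie at distance 1 from it.\<close>
    have "circ_dist k s s = 0" by (simp add: circ_dist_def)
    with s \<open>3 \<le> k\<close> that \<open>pred s \<in> S\<close>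
    have "{succ s, pred s} \<subseteq> {r \<in> S. r \<noteq> s \<and> circ_dist k s r = 1}"
      using circ_dist_succ[of k s] circ_dist_pred[of k s] by (auto simp: succ_def pred_def)
    then have "card {succ s, pred s} \<le> card {r \<in> S. r \<noteq> s \<and> circ_dist k s r = 1}"
      by (intro card_mono) auto
    also have "\<dots> \<le> 1" using S that by (simp add: relaxed_color_set_def)
    finally show False
      using succ_mod_neq_pred_mod[OF \<open>3 \<le> k\<close> s] by (simp add: succ_def pred_def)
  qed
  have "inj_on g S"
    using inj_on_subset[OF inj_on_succ_mod sub] inj_on_subset[OF inj_on_pred_mod sub]
    by (auto simp: g_def inj_on_def succ_def pred_def)
  moreover have "g ` S \<subseteq> ({..<k} - S) \<times> UNIV"
    using free \<open>3 \<le> k\<close> by (auto simp: g_def succ_def pred_def)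
  ultimately have "card S \<le> card (({..<k} - S) \<times> (UNIV :: bool set))"
    by (intro card_inj_on_le) auto
  also have "\<dots> = 2 * (k - card S)"
    using sub by (simp add: card_cartesian_product card_Diff_subset)
  finally show ?thesis
    using card_relaxed_color_set_le[OF S] by linarith
qed

text \<open>The sequence 0, 1, 3, 4, 6, 7, ... has gaps alternating between 1 and 2, and a gap of 1
  follows exactly the even indices.\<close>

lemma three_halves_adjacent:
  assumes "3 * i div 2 + 1 = 3 * j div (2::nat)"
  shows "even i \<and> j = i + 1"
proof -
  have j: "j = i + 1"
    using assms by linarith
  have "even i"
  proof (rule ccontr)
    assume "odd i"
    then obtain m where m: "i = 2 * m + 1" by (rule oddE)
    then have "3 * i div 2 = 3 * m + 1" "3 * j div 2 = 3 * m + 3"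
      using j by simp_all
    with assms show False by simp
  qed
  with j show ?thesis by simp
qed

lemma relaxed_color_set_1_witness:
  assumes "3 * n \<le> 2 * k"
  shows "relaxed_color_set k 1 ((\<lambda>i. 3 * i div 2) ` {..<n})"
proof -
  have partner: "r = 3 * (if even i then i + 1 else i - 1) div 2"
    if "i < n" and r: "r \<in> (\<lambda>i. 3 * i div 2) ` {..<n}"
      and dist: "circ_dist k (3 * i div 2) r = 1" for i r
  proof -
    obtain j where j: "j < n" "r = 3 * j div 2" using r by auto
    \<comment> \<open>Since \<open>i\<close> is at most \<open>n - 1\<close>, the color is at most
      the floor of (2k - 3)/2, which is k - 2. So color k - 1 stays free and distance 1 never arises
      by wrapping around.\<close>
    have "3 * i div 2 + 2 \<le> k" "3 * j div 2 + 2 \<le> k"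
      using assms \<open>i < n\<close> \<open>j < n\<close> by linarith+
    then have "3 * i div 2 + 1 = 3 * j div 2 \<or> 3 * j div 2 + 1 = 3 * i div 2"
      using dist unfolding j circ_dist_def by linarith
    then have "j = (if even i then i + 1 else i - 1)"
      using three_halves_adjacent[of i j] three_halves_adjacent[of j i] by auto
    then show ?thesis by (simp only: j)
  qed
  \<comment> \<open>If \<open>n - 1\<close> is even, the partner of the last index falls outside the
    set; the singleton still serves as an upper bound.\<close>
  have "card {r \<in> (\<lambda>i. 3 * i div 2) ` {..<n}. r \<noteq> 3 * i div 2 \<and> circ_dist k (3 * i div 2) r = 1}
      \<le> card {3 * (if even i then i + 1 else i - 1) div 2}" if "i < n" for i
    using partner[OF that] by (intro card_mono subsetI) (simp, blast)
  moreover have "3 * i div 2 < k" if "i < n" for i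
    using assms that by linarith
  ultimately show ?thesis
    by (auto simp: relaxed_color_set_def)
qed

lemma card_relaxed_color_set_1_witness:
  "card ((\<lambda>i::nat. 3 * i div 2) ` {..<n}) = n"
proof -
  have "strict_mono (\<lambda>i::nat. 3 * i div 2)"
    by (rule strict_monoI) linarith
  then have "inj_on (\<lambda>i::nat. 3 * i div 2) {..<n}"
    by (rule strict_mono_imp_inj_on)
  then show ?thesis
    by (simp add: card_image)
qed

lemma relaxed_color_set_lessThan:
  assumes "2 \<le> t"
  shows "relaxed_color_set n t {..<n}"
proof -
  have "card {r \<in> {..<n}. r \<noteq> s \<and> circ_dist n s r = 1} \<le> 2" if "s < n" for s
  proof -
    have "{r \<in> {..<n}. r \<noteq> s \<and> circ_dist n s r = 1} \<subseteq> {(s + 1) mod n, (s + n - 1) mod n}"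
      using circ_dist_eq_1_cases that by blast
    then have "card {r \<in> {..<n}. r \<noteq> s \<and> circ_dist n s r = 1}
        \<le> card {(s + 1) mod n, (s + n - 1) mod n}"
      by (intro card_mono) auto
    also have "\<dots> \<le> 2" by (simp add: card_insert_if)
    finally show ?thesis .
  qed
  with assms show ?thesis
    unfolding relaxed_color_set_def by (meson lessThan_iff order_refl order_trans)
qed

text \<open>For \<open>t = 1\<close> the formula fails on small complete graphs: with one or two
  vertices the true values are 1 and 2, while the formula gives 2 and 3. Hence the condition
  \<open>3 \<le> n\<close> in that case.\<close>

theorem theorem2p3:
  fixes G :: "('a, 'b) pre_digraph" and n t :: nat
  assumes "1 \<le> t" and "1 \<le> n" and "K\<^bsub>n\<^esub> G"
    and "t = 1 \<Longrightarrow> 3 \<le> n"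
  shows "real (relaxed_circ_chromatic_number t G) =
    (if t = 1 \<and> even n then 3 * real n / 2
     else if t = 1 \<and> odd n then (3 * real n + 1) / 2
     else real n)"
proof (cases "t = 1")
  case True
  then have "3 \<le> n" by fact
  \<comment> \<open>This quotient is the ceiling of 3n/2, the least \<open>k\<close> with
    \<open>3 * n \<le> 2 * k\<close>, and covers both parities at once.\<close>
  have "relaxed_circ_chromatic_number t G = (3 * n + 1) div 2"
    unfolding relaxed_circ_chromatic_number_def relaxed_colorable_complete_iff[OF assms(3)] True
  proof (rule Least_equality)
    have "3 * n \<le> 2 * ((3 * n + 1) div 2)" by linarith
    then show "0 < (3 * n + 1) div 2 \<and>
        (\<exists>S. relaxed_color_set ((3 * n + 1) div 2) 1 S \<and> card S = n)"
      using relaxed_color_set_1_witness card_relaxed_color_set_1_witness \<open>3 \<le> n\<close> by force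
  next
    fix k assume "0 < k \<and> (\<exists>S. relaxed_color_set k 1 S \<and> card S = n)"
    then obtain S where S: "relaxed_color_set k 1 S" "card S = n" by blast
    \<comment> \<open>The \<open>n\<close> distinct colors force \<open>k\<close> to be at least
      \<open>n\<close>, which rules out the degenerate small cycles.\<close>
    then have "3 \<le> k" using card_relaxed_color_set_le \<open>3 \<le> n\<close> by fastforce
    with S have "3 * n \<le> 2 * k" using relaxed_color_set_1_bound by blast
    then show "(3 * n + 1) div 2 \<le> k" by linarith
  qed
  \<comment> \<open>Naming the quotient and doubling it turns the claim into a division-free
    identity that can be cast to the reals.\<close>
  moreover obtain c where c: "(3 * n + 1) div 2 = c" by blast
  moreover have "2 * c = 3 * n + (if even n then 0 else 1)"
    unfolding c[symmetric] by (cases "even n") (auto elim!: evenE oddE)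
  then have "real (2 * c) = real (3 * n + (if even n then 0 else 1))"
    by (rule arg_cong)
  ultimately show ?thesis
    using True by (simp split: if_splits)
next
  case False
  with assms have "2 \<le> t" by linarith
  have "relaxed_circ_chromatic_number t G = n"
    unfolding relaxed_circ_chromatic_number_def relaxed_colorable_complete_iff[OF assms(3)]
  proof (rule Least_equality)
    show "0 < n \<and> (\<exists>S. relaxed_color_set n t S \<and> card S = n)"
      using relaxed_color_set_lessThan[OF \<open>2 \<le> t\<close>] assms(2) by force
  qed (use card_relaxed_color_set_le in blast)
  with False show ?thesis by simp
qed

end
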